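(* If $\mathbb{F}$ and $\mathbb{K}$ are finite fields with different characteristics, then there exist networks $\mathcal{N}_1$ and $\mathcal{N}_2$ such that $\mathcal{C}_{lin}(\mathcal{N}_1,\mathbb{F}) > \mathcal{C}_{lin}(\mathcal{N}_1,\mathbb{K})$ and $\mathcal{C}_{lin}(\mathcal{N}_2,\mathbb{K}) > \mathcal{C}_{lin}(\mathcal{N}_2,\mathbb{F})$.
   Context: A network is a finite directed acyclic multigraph, some of whose nodes are sources or receivers, with finitely many message vectors (say $m$ of them), each originating at a source node; each receiver demands a specified set of the message vectors. The inputs of a node are the message vectors originating at the node together with the vectors carried by its incoming edges. For integers $k_1,\dots,k_m\ge 0$ and $n\ge 1$, a $(k_1,\dots,k_m,n)$ code over a finite alphabet $\mathcal{A}$ (with $|\mathcal{A}|\ge 2$) lets the $i$th message vector range over $\mathcal{A}^{k_i}$, assigns to each edge an edge function mapping the inputs of the edge's tail node to a vector in $\mathcal{A}^n$ (the vector carried by the edge), and assigns to each receiver and each message vector it demands a decoding function of the receiver's inputs. The code is a solution if, for all values of the message vectors, each decoding function outputs the demanded message vector. Its rate vector is $(k_1/n,\dots,k_m/n)$. For a finite field $\mathbb{F}$, a $(k_1,\dots,k_m,n)$ code over the alphabet $\mathbb{F}$ is linear if every edge function and decoding function is of the form $\mathbf{x}\mapsto A\mathbf{x}$, where $\mathbf{x}$ is the concatenation of the input vectors of the node and $A$ is a matrix over $\mathbb{F}$. A rate vector $\mathbf{r}$ is linearly achievable for $\mathcal{N}$ over $\mathbb{F}$ if $\mathcal{N}$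 has a linear solution over $\mathbb{F}$ (for some block sizes $k_1,\dots,k_m,n$) with rate vector $\mathbf{r}$. The linear capacity is $\mathcal{C}_{lin}(\mathcal{N},\mathbb{F})=\sup\{r\in\mathbb{Q} : (r,\dots,r)\text{ is linearly achievable for }\mathcal{N}\text{ over }\mathbb{F}\}$ (a supremum in the extended reals). *)

theory Defs
  imports
    "Graph_Theory.Digraph"
    "Jordan_Normal_Form.Matrix"
    "HOL-Library.Extended_Real"
begin

text \<open>
  Nodes and edges are named by natural numbers, which loses no finite network.  The linear order
  on the names fixes the order in which the inputs of a node are concatenated.
  The message vectors are numbered by \<open>0, \<dots>, num_messages - 1\<close>.
\<close>

record net =
  net_graph :: "(nat, nat) pre_digraph"
  sources :: "nat set"
  receivers :: "nat set"
  num_messages :: nat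
  origin :: "nat \<Rightarrow> nat"
  demands :: "nat \<Rightarrow> nat set"

locale network =
  fixes N :: net
  assumes fin_digraph: "fin_digraph (net_graph N)"
    and acyclic: "acyclic (arcs_ends (net_graph N))"
    and sources_subset: "sources N \<subseteq> verts (net_graph N)"
    and receivers_subset: "receivers N \<subseteq> verts (net_graph N)"
    and origin_in_sources: "i < num_messages N \<Longrightarrow> origin N i \<in> sources N"
    and demands_subset: "v \<in> receivers N \<Longrightarrow> demands N v \<subseteq> {..<num_messages N}"

definition messages_at :: "net \<Rightarrow> nat \<Rightarrow> nat list" where
  "messages_at N v = filter (\<lambda>i. origin N i = v) [0..<num_messages N]"

definition in_edges :: "net \<Rightarrow> nat \<Rightarrow> nat list" where
  "in_edges N v = sorted_list_of_set (in_arcs (net_graph N) v)"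

text \<open>Below, \<open>x i\<close> is the value of the \<open>i\<close>th message vector and \<open>z e\<close> the vector carried by
  the edge \<open>e\<close>; message \<open>i\<close> has length \<open>k i\<close>, and edge vectors have length \<open>n\<close>.\<close>

definition inputs :: "net \<Rightarrow> (nat \<Rightarrow> 'a vec) \<Rightarrow> (nat \<Rightarrow> 'a vec) \<Rightarrow> nat \<Rightarrow> 'a vec list" where
  "inputs N x z v = map x (messages_at N v) @ map z (in_edges N v)"

definition input_dims :: "net \<Rightarrow> (nat \<Rightarrow> nat) \<Rightarrow> nat \<Rightarrow> nat \<Rightarrow> nat list" where
  "input_dims N k n v = map k (messages_at N v) @ map (\<lambda>e. n) (in_edges N v)"

definition input_space :: "net \<Rightarrow> (nat \<Rightarrow> nat) \<Rightarrow> nat \<Rightarrow> nat \<Rightarrow> 'a vec list set" where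
  "input_space N k n v = {xs. map dim_vec xs = input_dims N k n v}"

text \<open>The alphabet of a code is the type \<open>'a\<close>.\<close>

record 'a code =
  edge_fun :: "nat \<Rightarrow> 'a vec list \<Rightarrow> 'a vec"
  decode_fun :: "nat \<Rightarrow> nat \<Rightarrow> 'a vec list \<Rightarrow> 'a vec"

definition is_code :: "net \<Rightarrow> (nat \<Rightarrow> nat) \<Rightarrow> nat \<Rightarrow> 'a::finite code \<Rightarrow> bool" where
  "is_code N k n C \<longleftrightarrow> card (UNIV :: 'a set) \<ge> 2 \<and> n \<ge> 1 \<and>
     (\<forall>e\<in>arcs (net_graph N).
        \<forall>xs\<in>input_space N k n (tail (net_graph N) e). edge_fun C e xs \<in> carrier_vec n) \<and>
     (\<forall>v\<in>receivers N. \<forall>i\<in>demands N v.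
        \<forall>xs\<in>input_space N k n v. decode_fun C v i xs \<in> carrier_vec (k i))"

definition carried :: "net \<Rightarrow> 'a code \<Rightarrow> (nat \<Rightarrow> 'a vec) \<Rightarrow> (nat \<Rightarrow> 'a vec) \<Rightarrow> bool" where
  "carried N C x z \<longleftrightarrow>
     (\<forall>e\<in>arcs (net_graph N). z e = edge_fun C e (inputs N x z (tail (net_graph N) e)))"

text \<open>By the lemmas \<open>carried_exists\<close> and \<open>carried_unique\<close> below, the family \<open>z\<close> quantified here
  exists and is determined on the edges by \<open>x\<close>.\<close>

definition is_solution :: "net \<Rightarrow> (nat \<Rightarrow> nat) \<Rightarrow> nat \<Rightarrow> 'a::finite code \<Rightarrow> bool" where
  "is_solution N k n C \<longleftrightarrow> is_code N k n C \<and>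
     (\<forall>x z. (\<forall>i<num_messages N. x i \<in> carrier_vec (k i)) \<longrightarrow> carried N C x z \<longrightarrow>
        (\<forall>v\<in>receivers N. \<forall>i\<in>demands N v. decode_fun C v i (inputs N x z v) = x i))"

definition concat_vec :: "'a vec list \<Rightarrow> 'a vec" where
  "concat_vec xs = foldr (@\<^sub>v) xs vNil"

definition is_linear :: "net \<Rightarrow> (nat \<Rightarrow> nat) \<Rightarrow> nat \<Rightarrow> 'f::{field,finite} code \<Rightarrow> bool" where
  "is_linear N k n C \<longleftrightarrow>
     (\<forall>e\<in>arcs (net_graph N).
        \<exists>A \<in> carrier_mat n (sum_list (input_dims N k n (tail (net_graph N) e))).
          \<forall>xs\<in>input_space N k n (tail (net_graph N) e).
            edge_fun C e xs = A *\<^sub>v concat_vec xs) \<and>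
     (\<forall>v\<in>receivers N. \<forall>i\<in>demands N v.
        \<exists>A \<in> carrier_mat (k i) (sum_list (input_dims N k n v)).
          \<forall>xs\<in>input_space N k n v. decode_fun C v i xs = A *\<^sub>v concat_vec xs)"

text \<open>Only the entries of a rate vector below \<open>num_messages N\<close> are relevant.\<close>

definition linearly_achievable :: "net \<Rightarrow> 'f::{field,finite} itself \<Rightarrow> (nat \<Rightarrow> rat) \<Rightarrow> bool" where
  "linearly_achievable N F r \<longleftrightarrow>
     (\<exists>k n. \<exists>C :: 'f code. is_solution N k n C \<and> is_linear N k n C \<and>
        (\<forall>i<num_messages N. r i = of_nat (k i) / of_nat n))"

definition linear_capacity :: "net \<Rightarrow> 'f::{field,finite} itself \<Rightarrow> ereal" where
  "linear_capacity N F =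
     Sup {ereal (of_rat r) | r :: rat. linearly_achievable N F (\<lambda>_. r)}"

context network
begin

lemma set_in_edges: "set (in_edges N v) = in_arcs (net_graph N) v"
proof -
  interpret G: fin_digraph "net_graph N" by (rule fin_digraph)
  show ?thesis unfolding in_edges_def by (simp add: G.finite_in_arcs)
qed

lemma inputs_cong:
  assumes "\<And>d. d \<in> in_arcs (net_graph N) v \<Longrightarrow> z d = z' d"
  shows "inputs N x z v = inputs N x z' v"
  unfolding inputs_def using assms by (simp add: set_in_edges)

definition edge_rel :: "(nat \<times> nat) set" where
  "edge_rel = {(d, e). d \<in> arcs (net_graph N) \<and> e \<in> arcs (net_graph N) \<and>
     head (net_graph N) d = tail (net_graph N) e}"

lemma wf_edge_rel: "wf edge_rel"
proof -
  interpret G: fin_digraph "net_graph N" by (rule fin_digraph)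
  have "finite (arcs_ends (net_graph N))" unfolding arcs_ends_def by simp
  then have "wf (arcs_ends (net_graph N))"
    using acyclic by (rule finite_acyclic_wf)
  then have "wf (inv_image (arcs_ends (net_graph N)) (tail (net_graph N)))"
    by (rule wf_inv_image)
  moreover have "edge_rel \<subseteq> inv_image (arcs_ends (net_graph N)) (tail (net_graph N))"
    unfolding edge_rel_def inv_image_def arcs_ends_conv by force
  ultimately show ?thesis by (rule wf_subset)
qed

lemma carried_exists: "\<exists>z. carried N C x z"
proof -
  let ?H = "\<lambda>z e. edge_fun C e (inputs N x z (tail (net_graph N) e))"
  let ?z = "wfrec edge_rel ?H"
  have "?z e = ?H ?z e" if e: "e \<in> arcs (net_graph N)" for e
  proof -
    have "?z e = ?H (cut ?z edge_rel e) e"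
      by (rule wfrec[OF wf_edge_rel])
    also have "inputs N x (cut ?z edge_rel e) (tail (net_graph N) e) =
        inputs N x ?z (tail (net_graph N) e)"
      by (rule inputs_cong) (use e in \<open>auto simp: cut_def edge_rel_def\<close>)
    finally show ?thesis .
  qed
  then show ?thesis unfolding carried_def by blast
qed

lemma carried_unique:
  assumes "carried N C x z" "carried N C x z'" "e \<in> arcs (net_graph N)"
  shows "z e = z' e"
  using assms(3)
proof (induction e rule: wf_induct_rule[OF wf_edge_rel])
  case (1 e)
  have "inputs N x z (tail (net_graph N) e) = inputs N x z' (tail (net_graph N) e)"
    by (rule inputs_cong) (use 1 in \<open>auto simp: edge_rel_def\<close>)
  then show ?case using assms(1,2) 1(2) unfolding carried_def by metis
qed

end

end

theory Submission
  imports Defs "HOL-Library.Function_Algebras" "HOL-Computational_Algebra.Euclidean_Algorithm"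
begin

text \<open>
  For \<open>M \<ge> 2\<close> consider a network with messages \<open>x\<^sub>0, \<dots>, x\<^bsub>M-1\<^esub>\<close> and bottleneck edges
  \<open>e\<^sub>0, \<dots>, e\<^sub>M\<close>, where \<open>e\<^sub>i\<close> depends on all messages except \<open>x\<^sub>i\<close> (on all messages if \<open>i = M\<close>).
  For each \<open>i < M\<close> a receiver sees \<open>e\<^sub>i\<close> and \<open>e\<^sub>M\<close> and demands \<open>x\<^sub>i\<close>; one more receiver sees
  \<open>e\<^sub>0, \<dots>, e\<^bsub>M-1\<^esub>\<close> and demands \<open>x\<^sub>0\<close>.  Letting each edge carry the sum of its messages \<open>x\<^sub>j\<close>
  gives rate 1 as soon as \<open>M - 1\<close> is invertible, because then
  \<open>e\<^sub>0 + \<dots> + e\<^bsub>M-1\<^esub> = (M - 1) e\<^sub>M\<close> yields \<open>e\<^sub>M\<close> and \<open>x\<^sub>0 = e\<^sub>M - e\<^sub>0\<close>.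

  If the characteristic is \<open>M - 1\<close>, the first \<open>M\<close> receivers force every code to look
  approximately like that one up to a change of coordinates, while the sum code loses \<open>x\<^sub>0\<close>.
  Counting makes this precise: on the subgroup of message tuples all of whose components
  contribute the same vector to \<open>e\<^sub>M\<close>, the edge \<open>e\<^sub>M\<close> carries \<open>M\<close> times, hence once, this common
  vector, so that removing \<open>x\<^sub>i\<close> makes \<open>e\<^sub>M\<close> vanish.  The edge \<open>e\<^sub>i\<close> then takes few values on the
  subgroup, but together \<open>e\<^sub>0, \<dots>, e\<^bsub>M-1\<^esub>\<close> must separate its elements.  With \<open>a\<close> message values and
  \<open>b\<close> edge values this gives \<open>a\<^bsup>3M\<^esup> \<le> b\<^bsup>3M-1\<^esup>\<close>, so the capacity is at most \<open>1 - 1/(3M)\<close>.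
\<close>

section \<open>Counting\<close>

text \<open>Padding with zero rather than \<open>undefined\<close> makes the tuples over a subgroup
  a subgroup of the function type under pointwise operations.\<close>

definition tuples :: "nat \<Rightarrow> 'a::zero set \<Rightarrow> (nat \<Rightarrow> 'a) set" where
  "tuples m A = {f. (\<forall>i<m. f i \<in> A) \<and> (\<forall>i\<ge>m. f i = 0)}"

lemma bij_betw_tuples: "bij_betw (\<lambda>f. restrict f {..<m}) (tuples m A) ({..<m} \<rightarrow>\<^sub>E A)"
proof (rule bij_betwI[where g = "\<lambda>f i. if i < m then f i else 0"])
  show "(\<lambda>f. restrict f {..<m}) \<in> tuples m A \<rightarrow> ({..<m} \<rightarrow>\<^sub>E A)"
  proof (rule Pi_I)
    fix f assume f: "f \<in> tuples m A"
    have "restrict f {..<m} i \<in> A" if "i \<in> {..<m}" for i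
      using f that unfolding tuples_def by auto
    then show "restrict f {..<m} \<in> {..<m} \<rightarrow>\<^sub>E A" by (intro PiE_I) simp_all
  qed
  show "(\<lambda>f i. if i < m then f i else 0) \<in> ({..<m} \<rightarrow>\<^sub>E A) \<rightarrow> tuples m A"
    unfolding tuples_def by (intro Pi_I CollectI) (simp, blast intro: PiE_mem)
  show "(\<lambda>i. if i < m then restrict f {..<m} i else 0) = f" if "f \<in> tuples m A" for f
    using that by (intro ext) (simp add: tuples_def)
  show "restrict (\<lambda>i. if i < m then f i else 0) {..<m} = f" if "f \<in> {..<m} \<rightarrow>\<^sub>E A" for f
    using that by (intro ext) (simp add: PiE_def extensional_def)
qed

lemma card_tuples: "card (tuples m A) = card A ^ m"
  using bij_betw_same_card[OF bij_betw_tuples[of m A]] by (simp add: card_PiE)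

lemma finite_tuples: "finite A \<Longrightarrow> finite (tuples m A)"
  using bij_betw_finite[OF bij_betw_tuples[of m A]] by (simp add: finite_PiE)

lemma tuples_diff:
  fixes A :: "'a::ab_group_add set"
  assumes "\<And>u v. u \<in> A \<Longrightarrow> v \<in> A \<Longrightarrow> u - v \<in> A" "f \<in> tuples m A" "g \<in> tuples m A"
  shows "f - g \<in> tuples m A"
  using assms by (auto simp: tuples_def)

lemma card_le_card_mult_fibre:
  assumes "finite Y" "\<phi> ` X \<subseteq> Y" "\<And>c. c \<in> Y \<Longrightarrow> card {x \<in> X. \<phi> x = c} \<le> t"
  shows "card X \<le> card Y * t"
proof -
  have "X = (\<Union>c\<in>Y. {x \<in> X. \<phi> x = c})" using assms(2) by auto
  then have "card X \<le> (\<Sum>c\<in>Y. card {x \<in> X. \<phi> x = c})"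
    using card_UN_le[OF assms(1)] by metis
  also have "\<dots> \<le> card Y * t" using sum_bounded_above[of Y _ t] assms(3) by simp
  finally show ?thesis .
qed

definition single :: "nat \<Rightarrow> 'a::zero \<Rightarrow> nat \<Rightarrow> 'a" where
  "single j u = (\<lambda>i. if i = j then u else 0)"

lemma single_diff: "single j (u - v) = single j u - single j (v :: 'a::ab_group_add)"
  by (auto simp: single_def)

lemma tuples_eq_sum_single:
  fixes x :: "nat \<Rightarrow> 'a::ab_group_add"
  assumes "x \<in> tuples m A"
  shows "x = (\<Sum>j<m. single j (x j))"
proof
  fix i
  have "(\<Sum>j<n. single j (x j)) i = (if i < n then x i else 0)" for n
    by (induction n) (auto simp: single_def)
  then show "x i = (\<Sum>j<m. single j (x j)) i" using assms by (auto simp: tuples_def)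
qed

text \<open>
  \<open>h i x\<close> plays the role of the vector carried by \<open>e\<^sub>i\<close>.  Assumption \<open>sum_const_B\<close> encodes that the
  characteristic divides \<open>M - 1\<close>.
\<close>

locale sum_decoding =
  fixes A :: "'a::ab_group_add set" and B :: "'b::ab_group_add set"
    and M :: nat and h :: "nat \<Rightarrow> (nat \<Rightarrow> 'a) \<Rightarrow> 'b"
  assumes finite_A: "finite A" and finite_B: "finite B"
    and zero_A: "0 \<in> A"
    and diff_A: "u \<in> A \<Longrightarrow> v \<in> A \<Longrightarrow> u - v \<in> A"
    and diff_B: "b \<in> B \<Longrightarrow> c \<in> B \<Longrightarrow> b - c \<in> B"
    and M_ge_2: "2 \<le> M"
    and sum_const_B: "b \<in> B \<Longrightarrow> (\<Sum>l<M. b) = b"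
    and h_in_B: "i \<le> M \<Longrightarrow> x \<in> tuples M A \<Longrightarrow> h i x \<in> B"
    and h_diff: "i \<le> M \<Longrightarrow> x \<in> tuples M A \<Longrightarrow> y \<in> tuples M A \<Longrightarrow> h i (x - y) = h i x - h i y"
    and h_local: "i < M \<Longrightarrow> x \<in> tuples M A \<Longrightarrow> y \<in> tuples M A \<Longrightarrow>
      (\<And>j. j \<noteq> i \<Longrightarrow> x j = y j) \<Longrightarrow> h i x = h i y"
    and decode: "i < M \<Longrightarrow> x \<in> tuples M A \<Longrightarrow> y \<in> tuples M A \<Longrightarrow>
      h M x = h M y \<Longrightarrow> h i x = h i y \<Longrightarrow> x i = y i"
    and decode_0: "x \<in> tuples M A \<Longrightarrow> y \<in> tuples M A \<Longrightarrow>
      (\<And>i. i < M \<Longrightarrow> h i x = h i y) \<Longrightarrow> x 0 = y 0"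
begin

section \<open>The aligned subgroup and the counting bound\<close>

abbreviation "X \<equiv> tuples M A"

definition aligned :: "(nat \<Rightarrow> 'a) set" where
  "aligned = {x \<in> X. \<forall>j<M. h M (single j (x j)) = h M (single 0 (x 0))}"

lemma zero_X: "0 \<in> X" using zero_A by (simp add: tuples_def)

lemma diff_X: "x \<in> X \<Longrightarrow> y \<in> X \<Longrightarrow> x - y \<in> X"
  by (rule tuples_diff) (auto intro: diff_A)

lemma add_X: assumes "x \<in> X" "y \<in> X" shows "x + y \<in> X"
proof -
  have "x - (0 - y) \<in> X" by (intro diff_X zero_X assms)
  then show ?thesis by simp
qed

lemma single_X: "j < M \<Longrightarrow> u \<in> A \<Longrightarrow> single j u \<in> X"
  using zero_A by (auto simp: tuples_def single_def)

lemma component_A: "x \<in> X \<Longrightarrow> j < M \<Longrightarrow> x j \<in> A"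
  by (simp add: tuples_def)

lemma h_zero: "i \<le> M \<Longrightarrow> h i 0 = 0"
  using h_diff[of i 0 0] zero_X by simp

lemma h_add: assumes "i \<le> M" "x \<in> X" "y \<in> X" shows "h i (x + y) = h i x + h i y"
proof -
  have n: "0 - y \<in> X" by (intro diff_X zero_X assms)
  have "h i (x - (0 - y)) = h i x - (h i 0 - h i y)"
    using assms n zero_X by (simp only: h_diff)
  then show ?thesis using assms by (simp add: h_zero)
qed

lemma h_sum:
  fixes n :: nat
  assumes "i \<le> M" "\<And>l. l < n \<Longrightarrow> f l \<in> X"
  shows "(\<Sum>l<n. f l) \<in> X \<and> h i (\<Sum>l<n. f l) = (\<Sum>l<n. h i (f l))"
  using assms(2) by (induction n) (auto simp: zero_X h_zero assms(1) add_X h_add)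

text \<open>\<open>h j\<close> ignores component \<open>j\<close>, so it cannot separate the two
  tuples; as component \<open>j\<close> is decodable from \<open>h M\<close> and \<open>h j\<close>,
  the map \<open>h M\<close> must separate them.\<close>

lemma inj_single:
  assumes "j < M" "u \<in> A" "v \<in> A" "h M (single j u) = h M (single j v)"
  shows "u = v"
proof -
  have "h j (single j u) = h j (single j v)"
    by (rule h_local) (use assms in \<open>auto simp: single_X, simp add: single_def\<close>)
  from decode[OF assms(1) _ _ assms(4) this] show ?thesis
    using assms by (simp add: single_X) (simp add: single_def)
qed

text \<open>All \<open>M\<close> components contribute the same vector to \<open>h M\<close>, and
  \<open>M\<close> copies of it add up to one by \<open>sum_const_B\<close>.\<close>

lemma h_aligned:
  assumes "x \<in> aligned" "i < M"
  shows "h M x = h M (single i (x i))"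
proof -
  have x: "x \<in> X" "\<And>j. j < M \<Longrightarrow> h M (single j (x j)) = h M (single i (x i))"
    using assms unfolding aligned_def by (blast, metis (mono_tags, lifting) mem_Collect_eq)
  have "h M x = h M (\<Sum>j<M. single j (x j))"
    by (rule arg_cong[OF tuples_eq_sum_single[OF x(1)]])
  also have "\<dots> = (\<Sum>j<M. h M (single j (x j)))"
    using h_sum[of M M "\<lambda>j. single j (x j)"] x(1) by (simp add: single_X component_A)
  also have "\<dots> = (\<Sum>j<M. h M (single i (x i)))"
    by (rule sum.cong) (auto intro: x(2))
  also have "\<dots> = h M (single i (x i))"
    using assms x(1) by (intro sum_const_B h_in_B single_X component_A) auto
  finally show ?thesis .
qed

lemma card_X_le: "card X \<le> card B ^ (M - 1) * card aligned"
proof -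
  \<comment> \<open>Comparing component 0 with itself is omitted; the shift to \<open>Suc j\<close>
    leaves \<open>M - 1\<close> coordinates, the exponent of \<open>card B\<close>.\<close>
  define \<phi> where "\<phi> x = (\<lambda>j. if j < M - 1 then h M (single (Suc j) (x (Suc j))) - h M (single 0 (x 0)) else 0)" for x
  have \<phi>_diff: "\<phi> (x - y) = \<phi> x - \<phi> y" if "x \<in> X" "y \<in> X" for x y
    using that M_ge_2
    by (auto simp: \<phi>_def single_diff h_diff single_X component_A)
  have "x \<in> aligned" if "x \<in> X" "\<phi> x = 0" for x
    unfolding aligned_def
  proof (intro CollectI conjI allI impI that)
    fix j assume "j < M"
    then show "h M (single j (x j)) = h M (single 0 (x 0))"
      using fun_cong[OF that(2), of "j - 1"] by (cases j) (auto simp: \<phi>_def less_diff_conv)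
  qed
  then have sub: "{x \<in> X. \<phi> x = 0} \<subseteq> aligned" by auto
  have fin: "finite aligned" unfolding aligned_def by (simp add: finite_tuples finite_A)
  have "card {x \<in> X. \<phi> x = c} \<le> card aligned" for c
  proof (cases "{x \<in> X. \<phi> x = c} = {}")
    case False
    then obtain y where y: "y \<in> X" "\<phi> y = c" by auto
    \<comment> \<open>A nonempty fibre of this homomorphism is a translate of its kernel.\<close>
    have "(\<lambda>x. x - y) ` {x \<in> X. \<phi> x = c} \<subseteq> aligned"
      using sub y by (auto simp: diff_X \<phi>_diff)
    then show ?thesis by (intro card_inj_on_le[OF _ _ fin]) (auto simp: inj_on_def)
  qed (simp only: card.empty)
  moreover have "\<phi> ` X \<subseteq> tuples (M - 1) B"
    using M_ge_2 unfolding tuples_def[of "M - 1"]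
    by (auto simp: \<phi>_def intro!: diff_B h_in_B single_X component_A)
  ultimately have "card X \<le> card (tuples (M - 1) B) * card aligned"
    by (intro card_le_card_mult_fibre) (auto simp: finite_tuples finite_B)
  then show ?thesis by (simp add: card_tuples)
qed

text \<open>
  If \<open>h M w = 0\<close> and \<open>w i = 0\<close>, then \<open>h i w\<close> and any components \<open>u\<close>, \<open>v\<close> at \<open>j\<close>, \<open>i\<close> can be
  recovered from the values of \<open>h M\<close> and \<open>h i\<close> at \<open>w + single j u + single i v\<close>: decoding yields
  \<open>v\<close>, then \<open>u\<close>, and the rest is \<open>h i w\<close>.
\<close>

lemma card_image_aligned:
  assumes i: "i < M"
  shows "card (h i ` aligned) * card A ^ 2 \<le> card B ^ 2"
proof -
  define j :: nat where "j = (if i = 0 then 1 else 0)"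
  have j: "j < M" "j \<noteq> i" using M_ge_2 by (auto simp: j_def)
  \<comment> \<open>\<open>t\<close> stands for \<open>h i x\<close> with \<open>x\<close> aligned.
    The second coordinate has no term for \<open>v\<close> because \<open>h i\<close> ignores
    component \<open>i\<close>.\<close>
  define \<psi> where "\<psi> = (\<lambda>(t, u, v). (h M (single j u + single i v), t + h i (single j u)))"
  have add_B: "b + c \<in> B" if "b \<in> B" "c \<in> B" for b c
  proof -
    have "b - ((c - c) - c) \<in> B" using that by (intro diff_B)
    then show ?thesis by simp
  qed
  have "\<psi> ` (h i ` aligned \<times> A \<times> A) \<subseteq> B \<times> B"
    using i j by (auto simp: \<psi>_def aligned_def intro!: add_B h_in_B add_X single_X)
  moreover have "inj_on \<psi> (h i ` aligned \<times> A \<times> A)"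
  proof -
    define w where "w x = x - single i (x i)" for x :: "nat \<Rightarrow> 'a"
    have w: "w x \<in> X" "h M (w x) = 0" "h i (w x) = h i x" "w x i = 0" if "x \<in> aligned" for x
    proof -
      have x: "x \<in> X" "x i \<in> A" using that i by (auto simp: aligned_def component_A)
      show wx: "w x \<in> X" using x i by (simp add: w_def diff_X single_X)
      show "h M (w x) = 0" using h_aligned[OF that i] x i by (simp add: w_def h_diff single_X)
      show "h i (w x) = h i x" by (rule h_local[OF i wx x(1)]) (simp add: w_def single_def)
      show "w x i = 0" by (simp add: w_def single_def)
    qed
    have si: "h i (single i v) = 0" if "v \<in> A" for v
    proof -
      have "h i (single i v) = h i 0"
        by (rule h_local) (use that i in \<open>auto simp: single_X zero_X, simp add: single_def\<close>)
      then show ?thesis using i by (simp add: h_zero)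
    qed
    have inj: "h i x = h i x' \<and> u = u' \<and> v = v'"
      if x: "x \<in> aligned" "x' \<in> aligned" and A: "u \<in> A" "v \<in> A" "u' \<in> A" "v' \<in> A"
        and eM: "h M (single j u + single i v) = h M (single j u' + single i v')"
        and ei: "h i x + h i (single j u) = h i x' + h i (single j u')"
      for x x' u u' v v'
    proof -
      \<comment> \<open>A tuple at which \<open>h M\<close> and \<open>h i\<close> take the two
        coordinates of \<psi>, so that decoding applies to it.\<close>
      define m where "m x u v = w x + (single j u + single i v)" for x u v
      have m: "m x u v \<in> X" "h M (m x u v) = h M (single j u + single i v)"
        "h i (m x u v) = h i x + h i (single j u)" "m x u v i = v"
        if "x \<in> aligned" "u \<in> A" "v \<in> A" for x u v
        using that i j w[OF that(1)] si
        by (auto simp: m_def h_add add_X single_X) (simp add: single_def)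
      have v: "v = v'"
        using decode[OF i, of "m x u v" "m x' u' v'"] m x A eM ei by simp
      then have "h M (single j u) = h M (single j u')"
        using eM A i j by (simp add: h_add single_X)
      then have "u = u'" using inj_single j(1) A by blast
      then show ?thesis using v ei by simp
    qed
    show ?thesis
    proof (rule inj_onI)
      fix a b
      assume "a \<in> h i ` aligned \<times> A \<times> A" "b \<in> h i ` aligned \<times> A \<times> A" and eq: "\<psi> a = \<psi> b"
      then obtain x u v x' u' v' where ab: "a = (h i x, u, v)" "b = (h i x', u', v')"
        and "x \<in> aligned" "x' \<in> aligned" "u \<in> A" "v \<in> A" "u' \<in> A" "v' \<in> A"
        by blast
      moreover have "h M (single j u + single i v) = h M (single j u' + single i v')"
        "h i x + h i (single j u) = h i x' + h i (single j u')"
        using eq by (simp_all add: ab \<psi>_def)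
      ultimately have "h i x = h i x' \<and> u = u' \<and> v = v'" by (intro inj)
      then show "a = b" by (simp add: ab)
    qed
  qed
  ultimately have "card (h i ` aligned \<times> A \<times> A) \<le> card (B \<times> B)"
    by (intro card_inj_on_le) (auto simp: finite_B)
  then show ?thesis by (simp add: card_cartesian_product power2_eq_square)
qed

text \<open>By \<open>decode_0\<close> the values of \<open>h 0\<close> to \<open>h (M - 1)\<close>
  determine component 0, hence the common contribution to \<open>h M\<close>, hence by
  \<open>inj_single\<close> every other component.\<close>

lemma card_aligned_le: "card aligned \<le> (\<Prod>i<M. card (h i ` aligned))"
proof -
  have fin: "finite aligned" unfolding aligned_def by (simp add: finite_tuples finite_A)
  have "inj_on (\<lambda>x. \<lambda>i\<in>{..<M}. h i x) aligned"
  proof (rule inj_onI)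
    fix x y assume x: "x \<in> aligned" and y: "y \<in> aligned"
      and eq: "(\<lambda>i\<in>{..<M}. h i x) = (\<lambda>i\<in>{..<M}. h i y)"
    have X: "x \<in> X" "y \<in> X" using x y by (auto simp: aligned_def)
    have "h i x = h i y" if "i < M" for i using fun_cong[OF eq, of i] that by simp
    then have 0: "x 0 = y 0" using X by (intro decode_0)
    have "x j = y j" if "j < M" for j
    proof (rule inj_single[OF that])
      show "x j \<in> A" "y j \<in> A" using X that by (simp_all add: component_A)
      have "h M (single j (x j)) = h M (single 0 (x 0))" using x that unfolding aligned_def by blast
      also have "\<dots> = h M (single j (y j))" using y that unfolding 0 aligned_def by (metis (mono_tags, lifting) mem_Collect_eq)
      finally show "h M (single j (x j)) = h M (single j (y j))" .
    qed
    moreover have "x j = y j" if "\<not> j < M" for j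
      using X that by (simp add: tuples_def)
    ultimately show "x = y" by blast
  qed
  then have "card aligned \<le> card (\<Pi>\<^sub>E i\<in>{..<M}. h i ` aligned)"
    by (rule card_inj_on_le) (auto intro!: finite_PiE fin split: if_splits)
  then show ?thesis by (simp add: card_PiE)
qed

text \<open>Each of the \<open>M\<close> images of \<open>aligned\<close> is paired with a factor
  \<open>card A ^ 2\<close> and bounded by \<open>card B ^ 2\<close>; the exponent of
  \<open>card B\<close> becomes \<open>(M - 1) + 2 * M\<close>.\<close>

theorem card_power_le: "card A ^ (3 * M) \<le> card B ^ (3 * M - 1)"
proof -
  have "card A ^ (3 * M) = card X * (card A ^ 2) ^ M"
    by (simp add: card_tuples flip: power_mult power_add)
  also have "\<dots> \<le> card B ^ (M - 1) * (\<Prod>i<M. card (h i ` aligned)) * (\<Prod>i<M. card A ^ 2)"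
    using order_trans[OF card_X_le mult_left_mono[OF card_aligned_le]]
    by (simp add: mult_right_mono)
  also have "\<dots> = card B ^ (M - 1) * (\<Prod>i<M. card (h i ` aligned) * card A ^ 2)"
    by (simp only: prod.distrib mult.assoc)
  also have "\<dots> \<le> card B ^ (M - 1) * (\<Prod>i<M. card B ^ 2)"
    by (intro mult_left_mono prod_mono) (auto intro: card_image_aligned)
  also have "\<dots> = card B ^ (3 * M - 1)"
    using M_ge_2 by (simp flip: power_mult power_add)
  finally show ?thesis .
qed

end

section \<open>Linear codes\<close>

lemma concat_vec_simps [simp]:
  "concat_vec [] = vNil" "concat_vec (x # xs) = x @\<^sub>v concat_vec xs"
  by (simp_all add: concat_vec_def)

lemma dim_concat_vec: "dim_vec (concat_vec xs) = sum_list (map dim_vec xs)"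
  by (induction xs) auto

lemma concat_vec_map_diff:
  fixes f g :: "'b \<Rightarrow> 'a::ab_group_add vec"
  assumes "\<And>l. l \<in> set L \<Longrightarrow> dim_vec (f l) = dim_vec (g l)"
  shows "concat_vec (map (\<lambda>l. f l - g l) L) = concat_vec (map f L) - concat_vec (map g L)"
  using assms
proof (induction L)
  case (Cons l L)
  have "dim_vec (concat_vec (map f L)) = dim_vec (concat_vec (map g L))"
    using Cons.prems by (auto simp: dim_concat_vec comp_def intro!: arg_cong[where f = sum_list])
  with Cons show ?case by (intro eq_vecI) auto
qed auto

text \<open>A single tagged list turns both the inputs and their dimensions into maps over the same
  index list.\<close>

definition input_names :: "net \<Rightarrow> nat \<Rightarrow> (nat + nat) list" where
  "input_names N v = map Inl (messages_at N v) @ map Inr (in_edges N v)"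

lemma inputs_eq_map: "inputs N x z v = map (case_sum x z) (input_names N v)"
  by (simp add: inputs_def input_names_def)

lemma input_dims_eq_map: "input_dims N k n v = map (case_sum k (\<lambda>_. n)) (input_names N v)"
  by (simp add: input_dims_def input_names_def)

definition row_mat :: "('b \<Rightarrow> 'a) \<Rightarrow> 'b list \<Rightarrow> 'a mat" where
  "row_mat c L = mat 1 (length L) (\<lambda>(_, t). c (L ! t))"

lemma concat_vec_map_scalar:
  assumes "\<And>l. l \<in> set L \<Longrightarrow> dim_vec (f l) = 1"
  shows "concat_vec (map f L) = vec (length L) (\<lambda>t. f (L ! t) $ 0)"
  using assms
proof (induction L)
  case (Cons l L)
  then show ?case by (intro eq_vecI) (auto simp: nth_Cons' less_Suc_eq_0_disj)
qed auto

lemma row_mat_mult_concat_vec: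
  fixes c :: "'b \<Rightarrow> 'a::comm_semiring_0"
  assumes "\<And>l. l \<in> set L \<Longrightarrow> dim_vec (f l) = 1"
  shows "row_mat c L *\<^sub>v concat_vec (map f L) = vec 1 (\<lambda>_. \<Sum>l\<leftarrow>L. c l * f l $ 0)"
proof (rule eq_vecI)
  fix s assume "s < dim_vec (vec 1 (\<lambda>_. \<Sum>l\<leftarrow>L. c l * f l $ 0))"
  then show "(row_mat c L *\<^sub>v concat_vec (map f L)) $ s = vec 1 (\<lambda>_. \<Sum>l\<leftarrow>L. c l * f l $ 0) $ s"
    using assms
    by (simp add: concat_vec_map_scalar row_mat_def scalar_prod_def sum_list_sum_nth)
qed (simp add: row_mat_def)

definition row_code ::
    "net \<Rightarrow> (nat \<Rightarrow> nat + nat \<Rightarrow> 'a) \<Rightarrow> (nat \<Rightarrow> nat \<Rightarrow> nat + nat \<Rightarrow> 'a) \<Rightarrow> 'a::semiring_0 code" where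
  "row_code N \<alpha> \<beta> =
     \<lparr>edge_fun = \<lambda>e xs. row_mat (\<alpha> e) (input_names N (tail (net_graph N) e)) *\<^sub>v concat_vec xs,
      decode_fun = \<lambda>v i xs. row_mat (\<beta> v i) (input_names N v) *\<^sub>v concat_vec xs\<rparr>"

text \<open>The output of a one-row matrix at \<open>v\<close>, summed over sets so that the
  concatenation order disappears.\<close>

definition input_sum :: "net \<Rightarrow> (nat + nat \<Rightarrow> 'a) \<Rightarrow> (nat \<Rightarrow> 'a) \<Rightarrow> (nat \<Rightarrow> 'a) \<Rightarrow> nat \<Rightarrow> 'a::semiring_0" where
  "input_sum N c \<xi> \<zeta> v =
     (\<Sum>i | i < num_messages N \<and> origin N i = v. c (Inl i) * \<xi> i) +
     (\<Sum>d\<in>in_arcs (net_graph N) v. c (Inr d) * \<zeta> d)"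

context network
begin

lemma input_sum_eq_sum_list:
  "input_sum N c \<xi> \<zeta> v = (\<Sum>l\<leftarrow>input_names N v. c l * case_sum \<xi> \<zeta> l)"
proof -
  have "(\<Sum>i\<leftarrow>messages_at N v. c (Inl i) * \<xi> i) =
      (\<Sum>i | i < num_messages N \<and> origin N i = v. c (Inl i) * \<xi> i)"
    by (subst sum_list_distinct_conv_sum_set)
      (auto simp: messages_at_def intro!: sum.cong)
  moreover have "(\<Sum>d\<leftarrow>in_edges N v. c (Inr d) * \<zeta> d) =
      (\<Sum>d\<in>in_arcs (net_graph N) v. c (Inr d) * \<zeta> d)"
    by (subst sum_list_distinct_conv_sum_set) (auto simp: set_in_edges, simp add: in_edges_def)
  ultimately show ?thesis
    by (simp add: input_sum_def input_names_def comp_def)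
qed

lemma in_input_names:
  "l \<in> set (input_names N v) \<Longrightarrow>
   (\<exists>i<num_messages N. l = Inl i) \<or> (\<exists>e\<in>in_arcs (net_graph N) v. l = Inr e)"
  by (auto simp: input_names_def messages_at_def set_in_edges)

lemma inputs_in_space:
  assumes "\<And>i. i < num_messages N \<Longrightarrow> x i \<in> carrier_vec (k i)"
    and "\<And>e. e \<in> in_arcs (net_graph N) v \<Longrightarrow> z e \<in> carrier_vec n"
  shows "inputs N x z v \<in> input_space N k n v"
  using assms by (auto simp: input_space_def inputs_eq_map input_dims_eq_map dest!: in_input_names)

lemma inputs_cong_messages:
  assumes "\<And>i. i < num_messages N \<Longrightarrow> origin N i = v \<Longrightarrow> x i = y i"
    and "\<And>d. d \<in> in_arcs (net_graph N) v \<Longrightarrow> z d = w d"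
  shows "inputs N x z v = inputs N y w v"
  using assms by (auto simp: inputs_def messages_at_def set_in_edges)

text \<open>\<open>is_code\<close> constrains edge functions only on inputs of the right dimensions,
  so dimensions are propagated along the well-founded edge order.\<close>

lemma carried_carrier:
  assumes "is_code N k n C" and x: "\<And>i. i < num_messages N \<Longrightarrow> x i \<in> carrier_vec (k i)"
    and "carried N C x z" and "e \<in> arcs (net_graph N)"
  shows "z e \<in> carrier_vec n"
  using assms(4)
proof (induction e rule: wf_induct_rule[OF wf_edge_rel])
  case (1 e)
  have "inputs N x z (tail (net_graph N) e) \<in> input_space N k n (tail (net_graph N) e)"
    by (rule inputs_in_space[OF x]) (use 1 in \<open>auto simp: edge_rel_def\<close>)
  then show ?case using assms(1,3) 1(2) unfolding is_code_def carried_def by metis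
qed

text \<open>Each edge applies one matrix to its concatenated inputs, and concatenation respects
  differences. With \<open>carried_unique\<close> this yields the assumption \<open>h_diff\<close>
  of the counting locale.\<close>

lemma carried_diff:
  fixes C :: "'f::{field,finite} code"
  assumes code: "is_code N k n C" and lin: "is_linear N k n C"
    and x: "\<And>i. i < num_messages N \<Longrightarrow> x i \<in> carrier_vec (k i)"
    and y: "\<And>i. i < num_messages N \<Longrightarrow> y i \<in> carrier_vec (k i)"
    and z: "carried N C x z" and w: "carried N C y w"
  shows "carried N C (\<lambda>i. x i - y i) (\<lambda>e. z e - w e)"
  unfolding carried_def
proof
  fix e assume e: "e \<in> arcs (net_graph N)"
  define v where "v = tail (net_graph N) e"
  note zc = carried_carrier[OF code x z] and wc = carried_carrier[OF code y w]
  from lin e obtain A where A: "A \<in> carrier_mat n (sum_list (input_dims N k n v))"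
    and eA: "\<And>xs. xs \<in> input_space N k n v \<Longrightarrow> edge_fun C e xs = A *\<^sub>v concat_vec xs"
    unfolding is_linear_def v_def by blast
  have sx: "inputs N x z v \<in> input_space N k n v"
    by (intro inputs_in_space x zc) auto
  have sy: "inputs N y w v \<in> input_space N k n v"
    by (intro inputs_in_space y wc) auto
  have sd: "inputs N (\<lambda>i. x i - y i) (\<lambda>e. z e - w e) v \<in> input_space N k n v"
    by (intro inputs_in_space minus_carrier_vec x y zc wc) auto
  have dims: "dim_vec (case_sum x z l) = dim_vec (case_sum y w l)" if "l \<in> set (input_names N v)" for l
    using in_input_names[OF that] carrier_vecD[OF x] carrier_vecD[OF y]
      carrier_vecD[OF zc] carrier_vecD[OF wc] by auto
  have "inputs N (\<lambda>i. x i - y i) (\<lambda>e. z e - w e) v =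
      map (\<lambda>l. case_sum x z l - case_sum y w l) (input_names N v)"
    by (auto simp: inputs_eq_map split: sum.split)
  also have "concat_vec \<dots> = concat_vec (inputs N x z v) - concat_vec (inputs N y w v)"
    unfolding inputs_eq_map by (rule concat_vec_map_diff) (rule dims)
  finally have "concat_vec (inputs N (\<lambda>i. x i - y i) (\<lambda>e. z e - w e) v) =
      concat_vec (inputs N x z v) - concat_vec (inputs N y w v)" .
  moreover have "concat_vec xs \<in> carrier_vec (sum_list (input_dims N k n v))"
    if "xs \<in> input_space N k n v" for xs :: "'f vec list"
    using that by (intro carrier_vecI) (simp add: input_space_def dim_concat_vec)
  ultimately have "edge_fun C e (inputs N (\<lambda>i. x i - y i) (\<lambda>e. z e - w e) v) =
      edge_fun C e (inputs N x z v) - edge_fun C e (inputs N y w v)"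
    by (simp only: eA[OF sx] eA[OF sy] eA[OF sd] mult_minus_distrib_mat_vec[OF A] sx sy)
  also have "\<dots> = z e - w e" using z w e by (simp add: carried_def v_def)
  finally show "z e - w e = edge_fun C e (inputs N (\<lambda>i. x i - y i) (\<lambda>e. z e - w e) (tail (net_graph N) e))"
    by (simp add: v_def)
qed

text \<open>Vectors of length 1 are identified with their entries, which reduces a solution with all
  block sizes 1 to scalar equations.\<close>

lemma scalar_linearly_achievable:
  fixes \<alpha> :: "nat \<Rightarrow> nat + nat \<Rightarrow> 'f::{field,finite}"
  assumes dec: "\<And>\<xi> \<zeta> v i. (\<And>e. e \<in> arcs (net_graph N) \<Longrightarrow>
        \<zeta> e = input_sum N (\<alpha> e) \<xi> \<zeta> (tail (net_graph N) e)) \<Longrightarrow>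
      v \<in> receivers N \<Longrightarrow> i \<in> demands N v \<Longrightarrow> input_sum N (\<beta> v i) \<xi> \<zeta> v = \<xi> i"
  shows "linearly_achievable N TYPE('f) (\<lambda>_. 1)"
proof -
  let ?C = "row_code N \<alpha> \<beta>" and ?k = "\<lambda>_::nat. 1::nat"
  have dim: "row_mat c (input_names N v) \<in> carrier_mat 1 (sum_list (input_dims N ?k 1 v))" for c :: "_ \<Rightarrow> 'f" and v
  proof -
    have "input_dims N ?k 1 v = replicate (length (input_names N v)) 1"
      by (auto simp: input_dims_eq_map intro!: nth_equalityI split: sum.split)
    then show ?thesis by (simp add: row_mat_def sum_list_replicate)
  qed
  have "card {0, 1 :: 'f} \<le> card (UNIV :: 'f set)" by (intro card_mono) auto
  moreover have "row_mat c L *\<^sub>v w \<in> carrier_vec 1" for c :: "nat + nat \<Rightarrow> 'f" and L w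
    by (intro carrier_vecI) (simp add: row_mat_def)
  ultimately have code: "is_code N ?k 1 ?C"
    unfolding is_code_def row_code_def by simp
  have lin: "is_linear N ?k 1 ?C"
    unfolding is_linear_def row_code_def code.select_convs by (intro conjI ballI bexI[OF _ dim]; rule refl)
  have "is_solution N ?k 1 ?C"
    unfolding is_solution_def
  proof (intro conjI code allI impI ballI)
    fix x z v i
    assume x: "\<forall>i<num_messages N. x i \<in> carrier_vec 1" and z: "carried N ?C x z"
      and v: "v \<in> receivers N" and i: "i \<in> demands N v"
    have zc: "z e \<in> carrier_vec 1" if "e \<in> arcs (net_graph N)" for e
      using carried_carrier[OF code _ z that] x by simp
    let ?\<xi> = "\<lambda>i. x i $ 0" and ?\<zeta> = "\<lambda>e. z e $ 0"
    have row: "row_mat c (input_names N v) *\<^sub>v concat_vec (inputs N x z v) =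
        vec 1 (\<lambda>_. input_sum N c ?\<xi> ?\<zeta> v)" for c v
    proof -
      have "dim_vec (case_sum x z l) = 1" if "l \<in> set (input_names N v)" for l
        using in_input_names[OF that] x zc by (auto simp: carrier_vecD)
      then have "row_mat c (input_names N v) *\<^sub>v concat_vec (inputs N x z v) =
          vec 1 (\<lambda>_. \<Sum>l\<leftarrow>input_names N v. c l * case_sum x z l $ 0)"
        unfolding inputs_eq_map by (rule row_mat_mult_concat_vec)
      also have "(\<lambda>l. case_sum x z l $ 0) = case_sum ?\<xi> ?\<zeta>"
        by (auto simp: fun_eq_iff split: sum.split)
      then have "(\<Sum>l\<leftarrow>input_names N v. c l * case_sum x z l $ 0) = input_sum N c ?\<xi> ?\<zeta> v"
        by (simp add: input_sum_eq_sum_list fun_eq_iff)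
      finally show ?thesis .
    qed
    have "?\<zeta> e = input_sum N (\<alpha> e) ?\<xi> ?\<zeta> (tail (net_graph N) e)"
      if "e \<in> arcs (net_graph N)" for e
    proof -
      have "z e = vec 1 (\<lambda>_. input_sum N (\<alpha> e) ?\<xi> ?\<zeta> (tail (net_graph N) e))"
        using z that unfolding carried_def by (simp add: row_code_def row)
      from arg_cong[OF this, of "\<lambda>w. w $ 0"] show ?thesis
        by (simp only: index_vec zero_less_one)
    qed
    then have "input_sum N (\<beta> v i) ?\<xi> ?\<zeta> v = ?\<xi> i"
      by (rule dec[OF _ v i])
    then have "decode_fun ?C v i (inputs N x z v) = vec 1 (\<lambda>_. x i $ 0)"
      by (simp add: row_code_def row)
    moreover have "i < num_messages N" using demands_subset[OF v] i by auto
    then have "dim_vec (x i) = 1" using x by (simp add: carrier_vecD)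
    then have "vec 1 (\<lambda>_. x i $ 0) = x i" by (intro eq_vecI) simp_all
    ultimately show "decode_fun ?C v i (inputs N x z v) = x i" by simp
  qed
  then show ?thesis using lin unfolding linearly_achievable_def
    by (intro exI[of _ ?k] exI[of _ 1] exI[of _ ?C]) auto
qed

end

section \<open>The network\<close>

declare One_nat_def [simp del] \<comment> \<open>keeps \<open>node 1 i\<close> in the form used by the rewrite rules\<close>

definition node :: "nat \<Rightarrow> nat \<Rightarrow> nat" where "node c i = prod_encode (c, i)"

text \<open>Naming an edge by its endpoints lets tail and head be decoded from the name.\<close>

definition link :: "nat \<Rightarrow> nat \<Rightarrow> nat" where "link u v = prod_encode (u, v)"

lemma node_eq_iff [simp]: "node c i = node c' i' \<longleftrightarrow> c = c' \<and> i = i'"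
  by (simp add: node_def)

lemma link_eq_iff [simp]: "link u v = link u' v' \<longleftrightarrow> u = u' \<and> v = v'"
  by (simp add: link_def)

lemma prod_decode_node [simp]: "prod_decode (node c i) = (c, i)"
  by (simp add: node_def)

lemma prod_decode_link [simp]: "prod_decode (link u v) = (u, v)"
  by (simp add: link_def)

text \<open>
  The \<open>j\<close>th message originates at \<open>node 0 j\<close>, the bottleneck \<open>e\<^sub>i\<close> leads from \<open>node 1 i\<close> to
  \<open>node 2 i\<close>, and the receivers are the nodes \<open>node 3 l\<close>.
\<close>

definition sum_net_arcs :: "nat \<Rightarrow> nat set" where
  "sum_net_arcs M =
     {link (node 0 j) (node 1 i) | i j. i \<le> M \<and> j < M \<and> j \<noteq> i} \<union>
     {link (node 1 i) (node 2 i) | i. i \<le> M} \<union>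
     {link (node 2 i) (node 3 l) | i l. i \<le> M \<and> l < M \<and> (i = l \<or> i = M)} \<union>
     {link (node 2 i) (node 3 M) | i. i < M}"

text \<open>Reduction modulo \<open>M\<close> makes the extra receiver \<open>node 3 M\<close>
  demand message 0.\<close>

definition sum_net :: "nat \<Rightarrow> net" where
  "sum_net M =
     \<lparr>net_graph =
        \<lparr>verts = {node c i | c i. c < 4 \<and> i \<le> M}, arcs = sum_net_arcs M,
         tail = \<lambda>e. fst (prod_decode e), head = \<lambda>e. snd (prod_decode e)\<rparr>,
      sources = {node 0 j | j. j < M}, receivers = {node 3 l | l. l \<le> M},
      num_messages = M, origin = node 0, demands = \<lambda>v. {snd (prod_decode v) mod M}\<rparr>"

abbreviation "sum_graph M \<equiv> net_graph (sum_net M)"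

lemma sum_net_simps [simp]:
  "verts (sum_graph M) = {node c i | c i. c < 4 \<and> i \<le> M}"
  "arcs (sum_graph M) = sum_net_arcs M"
  "tail (sum_graph M) = (\<lambda>e. fst (prod_decode e))"
  "head (sum_graph M) = (\<lambda>e. snd (prod_decode e))"
  "sources (sum_net M) = {node 0 j | j. j < M}"
  "receivers (sum_net M) = {node 3 l | l. l \<le> M}"
  "num_messages (sum_net M) = M"
  "origin (sum_net M) = node 0"
  "demands (sum_net M) = (\<lambda>v. {snd (prod_decode v) mod M})"
  by (simp_all add: sum_net_def)

lemma finite_verts_sum_net: "finite {node c i | c i. c < 4 \<and> i \<le> M}"
proof (rule finite_subset)
  show "{node c i | c i. c < 4 \<and> i \<le> M} \<subseteq> (\<lambda>(c, i). node c i) ` ({..<4} \<times> {..M})" by auto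
qed simp

lemma sum_net_arcs_ends:
  assumes "e \<in> sum_net_arcs M"
  obtains c c' i i' where "e = link (node c i) (node c' i')" "c < c'" "c' < 4" "i \<le> M" "i' \<le> M"
proof -
  from assms consider
      (1) i j where "e = link (node 0 j) (node 1 i)" "i \<le> M" "j < M"
    | (2) i where "e = link (node 1 i) (node 2 i)" "i \<le> M"
    | (3) i l where "e = link (node 2 i) (node 3 l)" "i \<le> M" "l \<le> M"
    unfolding sum_net_arcs_def by fastforce
  then show thesis
  proof cases
    case 1
    then show ?thesis by (intro that[of 0 j 1 i]) auto
  next
    case 2
    then show ?thesis by (intro that[of 1 i 2 i]) auto
  next
    case 3
    then show ?thesis by (intro that[of 2 i 3 l]) auto
  qed
qed

lemma network_sum_net: assumes "0 < M" shows "network (sum_net M)"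
proof (rule network.intro)
  let ?V = "{node c i | c i. c < 4 \<and> i \<le> M}"
  have ends: "fst (prod_decode e) \<in> ?V \<and> snd (prod_decode e) \<in> ?V" if "e \<in> sum_net_arcs M" for e
    using that by (rule sum_net_arcs_ends) auto
  have "finite (sum_net_arcs M)"
  proof (rule finite_subset)
    show "sum_net_arcs M \<subseteq> (\<lambda>(u, v). link u v) ` (?V \<times> ?V)"
    proof
      fix e assume "e \<in> sum_net_arcs M"
      then show "e \<in> (\<lambda>(u, v). link u v) ` (?V \<times> ?V)"
        by (rule sum_net_arcs_ends) force
    qed
  qed (intro finite_imageI finite_cartesian_product finite_verts_sum_net)
  then show "fin_digraph (sum_graph M)"
    using ends by unfold_locales (auto simp: finite_verts_sum_net)
  \<comment> \<open>Edges lead to higher layers and all layers are below 4, so this measure strictly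
    decreases along them.\<close>
  have "arcs_ends (sum_graph M) \<subseteq> converse (measure (\<lambda>v. 4 - fst (prod_decode v)))"
    by (auto simp: arcs_ends_conv elim!: sum_net_arcs_ends)
  then show "acyclic (arcs_ends (sum_graph M))"
    by (meson acyclic_converse acyclic_subset wf_acyclic wf_measure)
qed (use assms in auto)

lemma in_arcs_sum_net:
  "in_arcs (sum_graph M) (node 0 j) = {}"
  "i \<le> M \<Longrightarrow> in_arcs (sum_graph M) (node 1 i) = (\<lambda>j. link (node 0 j) (node 1 i)) ` ({..<M} - {i})"
  "i \<le> M \<Longrightarrow> in_arcs (sum_graph M) (node 2 i) = {link (node 1 i) (node 2 i)}"
  "l < M \<Longrightarrow> in_arcs (sum_graph M) (node 3 l) = {link (node 2 l) (node 3 l), link (node 2 M) (node 3 l)}"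
  "in_arcs (sum_graph M) (node 3 M) = (\<lambda>i. link (node 2 i) (node 3 M)) ` {..<M}"
  by (auto simp: in_arcs_def sum_net_arcs_def)

section \<open>Rate 1 when \<open>M - 1\<close> is invertible\<close>

lemma linearly_achievable_sum_net:
  assumes M: "2 \<le> M" and nz: "of_nat (M - 1) \<noteq> (0 :: 'f::{field,finite})"
  shows "linearly_achievable (sum_net M) TYPE('f) (\<lambda>_. 1)"
proof -
  interpret network "sum_net M" using M by (intro network_sum_net) auto
  \<comment> \<open>\<open>t\<close> is the index of the bottleneck relayed by the edge. Receiver
    \<open>node 3 M\<close> divides the sum of its inputs by \<open>M - 1\<close> and subtracts
    input 0; the others subtract their own bottleneck from bottleneck \<open>M\<close>.\<close>
  define \<beta> :: "nat \<Rightarrow> nat \<Rightarrow> nat + nat \<Rightarrow> 'f" where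
    "\<beta> v i l = (case l of Inl j \<Rightarrow> 0 | Inr e \<Rightarrow>
       (let t = snd (prod_decode (fst (prod_decode e))) in
        if snd (prod_decode v) = M then inverse (of_nat (M - 1)) - of_bool (t = 0)
        else if t = M then 1 else -1))" for v i l
  show ?thesis
  proof (rule scalar_linearly_achievable[where \<alpha> = "\<lambda>_ _. 1" and \<beta> = \<beta>])
    fix \<xi> \<zeta> :: "nat \<Rightarrow> 'f" and v i
    assume \<zeta>: "\<And>e. e \<in> arcs (sum_graph M) \<Longrightarrow>
        \<zeta> e = input_sum (sum_net M) (\<lambda>_. 1) \<xi> \<zeta> (tail (sum_graph M) e)"
      and "v \<in> receivers (sum_net M)" and i: "i \<in> demands (sum_net M) v"
    then obtain l where v: "v = node 3 l" "l \<le> M" by auto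
    define S where "S = (\<Sum>j<M. \<xi> j)"
    have "{j. j < M \<and> node 0 j = node 0 j'} = {j'}" if "j' < M" for j' using that by auto
    then have \<zeta>0: "\<zeta> (link (node 0 j) (node 1 i)) = \<xi> j" if "i \<le> M" "j < M" "j \<noteq> i" for i j
      using that by (subst \<zeta>) (auto simp: sum_net_arcs_def input_sum_def in_arcs_sum_net)
    have "\<zeta> (link (node 1 i) (node 2 i)) = (\<Sum>j\<in>{..<M} - {i}. \<xi> j)" if "i \<le> M" for i
      using that by (subst \<zeta>)
        (auto simp: sum_net_arcs_def input_sum_def in_arcs_sum_net sum.reindex inj_on_def \<zeta>0)
    then have \<zeta>1: "\<zeta> (link (node 1 i) (node 2 i)) = (if i < M then S - \<xi> i else S)" if "i \<le> M" for i
      using that by (auto simp: S_def sum_diff1)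
    have \<zeta>2: "\<zeta> (link (node 2 i) (node 3 l)) = (if i < M then S - \<xi> i else S)"
      if "link (node 2 i) (node 3 l) \<in> sum_net_arcs M" for i l
    proof -
      have "i \<le> M" using that by (auto simp: sum_net_arcs_def)
      then show ?thesis using that by (subst \<zeta>) (auto simp: input_sum_def in_arcs_sum_net \<zeta>1)
    qed
    show "input_sum (sum_net M) (\<beta> v i) \<xi> \<zeta> v = \<xi> i"
    proof (cases "l = M")
      case True
      define a :: 'f where "a = inverse (of_nat (M - 1))"
      have "input_sum (sum_net M) (\<beta> v i) \<xi> \<zeta> v =
          (\<Sum>j<M. (a - of_bool (j = 0)) * (S - \<xi> j))"
        using v True
        by (simp add: input_sum_def in_arcs_sum_net sum.reindex inj_on_def \<beta>_def \<zeta>2 sum_net_arcs_def a_def del: of_nat_diff)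
      also have "\<dots> = a * (\<Sum>j<M. S - \<xi> j) - (\<Sum>j<M. of_bool (j = 0) * (S - \<xi> j))"
        by (simp add: left_diff_distrib sum_subtractf flip: sum_distrib_left)
      \<comment> \<open>Each message is missing from exactly one of the \<open>M\<close> partial
        sums.\<close>
      also have "(\<Sum>j<M. S - \<xi> j) = of_nat (M - 1) * S"
        using M by (simp add: sum_subtractf S_def[symmetric] of_nat_diff algebra_simps)
      also have "(\<Sum>j<M. of_bool (j = 0) * (S - \<xi> j)) = S - \<xi> 0"
        using M by (simp add: of_bool_def if_distrib[where f = "\<lambda>c. c * _"] sum.delta cong: if_cong)
      finally show ?thesis using i v True nz by (simp add: a_def del: of_nat_diff)
    next
      case False
      then have "input_sum (sum_net M) (\<beta> v i) \<xi> \<zeta> v = - (S - \<xi> l) + S"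
        using v
        by (simp add: input_sum_def in_arcs_sum_net \<beta>_def \<zeta>2 sum_net_arcs_def)
      then show ?thesis using i v False by simp
    qed
  qed
qed

section \<open>Upper bound in characteristic \<open>M - 1\<close>\<close>

lemma linear_solution_sum_net_bound:
  fixes C :: "'f::{field,finite} code"
  assumes M: "M = Suc CHAR('f)"
    and sol: "is_solution (sum_net M) ks n C" and lin: "is_linear (sum_net M) ks n C"
    and k: "\<And>i. i < M \<Longrightarrow> ks i = k"
  shows "3 * M * k \<le> (3 * M - 1) * n"
proof -
  have "0 < CHAR('f)" by (rule finite_imp_CHAR_pos) simp
  then have M2: "2 \<le> M" using M by simp
  interpret network "sum_net M" using M by (intro network_sum_net) auto
  have code: "is_code (sum_net M) ks n C" using sol by (simp add: is_solution_def)
  \<comment> \<open>The counting locale needs a group type, which vectors of varying dimension do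
    not form. Messages are therefore functions there, and \<open>m\<close> converts them.\<close>
  define m where "m x = (\<lambda>i. vec k (x i))" for x :: "nat \<Rightarrow> nat \<Rightarrow> 'f"
  define Z where "Z x = (SOME z. carried (sum_net M) C (m x) z)" for x
  have Z: "carried (sum_net M) C (m x) (Z x)" for x
    unfolding Z_def by (rule someI_ex[OF carried_exists])
  have m_carrier: "m x i \<in> carrier_vec (ks i)" if "i < num_messages (sum_net M)" for x i
    using that k by (simp add: m_def)
  define e where "e i = link (node 1 i) (node 2 i)" for i
  have e: "e i \<in> sum_net_arcs M" if "i \<le> M" for i
    using that by (auto simp: e_def sum_net_arcs_def)
  have Z_carrier: "Z x (e i) \<in> carrier_vec n" if "i \<le> M" for x i
    by (rule carried_carrier[OF code m_carrier Z]) (use e that in auto)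
  have Z_cong: "Z x d = Z y d"
    if d: "d \<in> sum_net_arcs M"
      and "\<And>i. i < M \<Longrightarrow> node 0 i = fst (prod_decode d) \<Longrightarrow> m x i = m y i"
      and "\<And>d'. d' \<in> in_arcs (sum_graph M) (fst (prod_decode d)) \<Longrightarrow> Z x d' = Z y d'" for x y d
  proof -
    have "inputs (sum_net M) (m x) (Z x) (fst (prod_decode d)) =
        inputs (sum_net M) (m y) (Z y) (fst (prod_decode d))"
      by (rule inputs_cong_messages) (use that in auto)
    then show ?thesis using Z[of x] Z[of y] d by (simp add: carried_def)
  qed
  \<comment> \<open>The only input of \<open>node 2 i\<close> is \<open>e i\<close>, so its outgoing
    edges carry no further information.\<close>
  have Z2_cong: "Z x (link (node 2 i) (node 3 l)) = Z y (link (node 2 i) (node 3 l))"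
    if "Z x (e i) = Z y (e i)" "link (node 2 i) (node 3 l) \<in> sum_net_arcs M" for x y i l
  proof -
    have "i \<le> M" using that(2) by (auto simp: sum_net_arcs_def)
    then show ?thesis using that
      by - (rule Z_cong, auto simp: in_arcs_sum_net e_def simp del: in_in_arcs_conv)
  qed
  \<comment> \<open>No message originates at a receiver, so its incoming edges alone determine the
    demanded message.\<close>
  have recv: "m x (l mod M) = m y (l mod M)"
    if "l \<le> M" "\<And>d. d \<in> in_arcs (sum_graph M) (node 3 l) \<Longrightarrow> Z x d = Z y d" for x y l
  proof -
    have "decode_fun C (node 3 l) (l mod M) (inputs (sum_net M) (m x) (Z x) (node 3 l)) = m x (l mod M)"
      for x
    proof -
      have "node 3 l \<in> receivers (sum_net M)" "l mod M \<in> demands (sum_net M) (node 3 l)"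
        using that(1) by auto
      then show ?thesis using sol Z[of x] m_carrier[of _ x] unfolding is_solution_def by blast
    qed
    moreover have "inputs (sum_net M) (m x) (Z x) (node 3 l) = inputs (sum_net M) (m y) (Z y) (node 3 l)"
      by (rule inputs_cong_messages) (use that in auto)
    ultimately show ?thesis by metis
  qed
  \<comment> \<open>Zero beyond \<open>n\<close> places the vector on \<open>e i\<close> in the
    group \<open>?B\<close>.\<close>
  define h where "h i x = (\<lambda>t. if t < n then Z x (e i) $ t else 0)" for i x
  have h_eq_iff: "h i x = h i y \<longleftrightarrow> Z x (e i) = Z y (e i)" if "i \<le> M" for i x y
  proof
    assume "h i x = h i y"
    then show "Z x (e i) = Z y (e i)"
      using Z_carrier[OF that, of x] Z_carrier[OF that, of y]
      by (intro eq_vecI) (auto simp: h_def fun_eq_iff, metis)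
  qed (simp add: h_def fun_eq_iff)
  let ?A = "tuples k (UNIV :: 'f set)" and ?B = "tuples n (UNIV :: 'f set)"
  have m_inj: "x i = y i" if "x \<in> tuples M ?A" "y \<in> tuples M ?A" "m x i = m y i" "i < M" for x y i
  proof
    fix t
    show "x i t = y i t"
    proof (cases "t < k")
      case True
      then show ?thesis using arg_cong[OF that(3), of "\<lambda>w. w $ t"] by (simp add: m_def)
    next
      case False
      then show ?thesis using that by (simp add: tuples_def)
    qed
  qed
  have "sum_decoding ?A ?B M h"
  proof
    show "finite ?A" "finite ?B" by (simp_all add: finite_tuples)
    show "0 \<in> ?A" by (simp add: tuples_def)
    show "u - v \<in> ?A" if "u \<in> ?A" "v \<in> ?A" for u v using that by (intro tuples_diff) auto
    show "u - v \<in> ?B" if "u \<in> ?B" "v \<in> ?B" for u v using that by (intro tuples_diff) auto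
    show "2 \<le> M" by (rule M2)
    show "(\<Sum>l<M. b) = b" for b :: "nat \<Rightarrow> 'f"
    proof
      fix t
      \<comment> \<open>\<open>M\<close> is \<open>CHAR('f) + 1\<close>, which equals 1 in the
        field.\<close>
      have "(\<Sum>l<r. b) t = of_nat r * b t" for r by (induction r) (auto simp: algebra_simps)
      then show "(\<Sum>l<M. b) t = b t" by (simp add: M)
    qed
    show "h i x \<in> ?B" for i x by (simp add: h_def tuples_def)
    show "h i (x - y) = h i x - h i y" if "i \<le> M" for i x y
    proof -
      have "carried (sum_net M) C (\<lambda>i. m x i - m y i) (\<lambda>e. Z x e - Z y e)"
        by (rule carried_diff[OF code lin m_carrier m_carrier Z Z])
      moreover have "(\<lambda>i. m x i - m y i) = m (x - y)" by (intro ext eq_vecI) (auto simp: m_def)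
      ultimately have "Z (x - y) (e i) = Z x (e i) - Z y (e i)"
        using carried_unique[OF Z] e[OF that] by simp
      then show ?thesis
        using Z_carrier[OF that, of x] Z_carrier[OF that, of y] by (auto simp: h_def)
    qed
    show "h i x = h i y" if "i < M" and xy: "\<And>j. j \<noteq> i \<Longrightarrow> x j = y j" for i x y
    proof -
      \<comment> \<open>Message \<open>i\<close> has no edge into \<open>node 1 i\<close>, and each
        of these edges sees only its own message.\<close>
      have "Z x (link (node 0 j) (node 1 i)) = Z y (link (node 0 j) (node 1 i))"
        if "j < M" "j \<noteq> i" for j
        using that \<open>i < M\<close> by - (rule Z_cong,
          auto simp: sum_net_arcs_def in_arcs_sum_net m_def xy simp del: in_in_arcs_conv)
      then have "Z x (e i) = Z y (e i)"
        using \<open>i < M\<close> e[of i] by - (rule Z_cong,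
          auto simp: e_def in_arcs_sum_net simp del: in_in_arcs_conv)
      then show ?thesis using \<open>i < M\<close> by (simp add: h_eq_iff)
    qed
    show "x i = y i"
      if i: "i < M" and "x \<in> tuples M ?A" "y \<in> tuples M ?A" "h M x = h M y" "h i x = h i y" for i x y
    proof -
      have "m x (i mod M) = m y (i mod M)"
        using that by (intro recv)
          (auto simp: in_arcs_sum_net h_eq_iff sum_net_arcs_def intro!: Z2_cong simp del: in_in_arcs_conv)
      then show ?thesis using that by (intro m_inj) auto
    qed
    show "x 0 = y 0"
      if "x \<in> tuples M ?A" "y \<in> tuples M ?A" "\<And>i. i < M \<Longrightarrow> h i x = h i y" for x y
    proof -
      have "m x (M mod M) = m y (M mod M)"
        using that by (intro recv)
          (auto simp: in_arcs_sum_net h_eq_iff sum_net_arcs_def intro!: Z2_cong simp del: in_in_arcs_conv)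
      then show ?thesis using that M2 by (intro m_inj) auto
    qed
  qed
  then have "card ?A ^ (3 * M) \<le> card ?B ^ (3 * M - 1)" by (rule sum_decoding.card_power_le)
  then have "card (UNIV :: 'f set) ^ (k * (3 * M)) \<le> card (UNIV :: 'f set) ^ (n * (3 * M - 1))"
    by (simp add: card_tuples power_mult)
  moreover have "card {0, 1 :: 'f} \<le> card (UNIV :: 'f set)" by (intro card_mono) auto
  then have "1 < card (UNIV :: 'f set)" by simp
  ultimately have "k * (3 * M) \<le> n * (3 * M - 1)"
    by (rule power_le_imp_le_exp[rotated])
  then show ?thesis by (simp add: mult.commute)
qed

section \<open>Separation of the capacities\<close>

lemma linear_capacity_sum_net_less_1:
  assumes M: "M = Suc CHAR('f::{field,finite})"
  shows "linear_capacity (sum_net M) TYPE('f) < 1"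
proof -
  \<comment> \<open>This is \<open>1 - 1 / (3 * M)\<close>. It bounds every achievable rate
    uniformly in the block sizes, so the supremum also stays below 1.\<close>
  define c :: real where "c = real (3 * M - 1) / real (3 * M)"
  have "linear_capacity (sum_net M) TYPE('f) \<le> ereal c"
    unfolding linear_capacity_def
  proof (rule Sup_least, clarify)
    fix r assume "linearly_achievable (sum_net M) TYPE('f) (\<lambda>_. r)"
    then obtain ks n and C :: "'f code" where sol: "is_solution (sum_net M) ks n C"
      and lin: "is_linear (sum_net M) ks n C" and r: "\<And>i. i < M \<Longrightarrow> r = of_nat (ks i) / of_nat n"
      by (auto simp: linearly_achievable_def)
    have n: "n \<ge> 1" using sol by (auto simp: is_solution_def is_code_def)
    have "ks i = ks 0" if "i < M" for i
      using r[OF that] r[of 0] n M by simp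
    then have "3 * M * ks 0 \<le> (3 * M - 1) * n"
      by (rule linear_solution_sum_net_bound[OF M sol lin])
    then have "real (3 * M) * real (ks 0) \<le> real (3 * M - 1) * real n"
      by (simp only: of_nat_le_iff flip: of_nat_mult)
    moreover have "a / b \<le> c / d" if "d * a \<le> c * b" "0 < b" "0 < d" for a b c d :: real
      using that by (simp add: field_simps)
    moreover have "0 < real n" "0 < real (3 * M)" using n M by simp_all
    ultimately have "real (ks 0) / real n \<le> c"
      unfolding c_def by blast
    moreover have "real_of_rat r = real (ks 0) / real n"
      using r[of 0] M by (simp add: of_rat_divide)
    ultimately show "ereal (real_of_rat r) \<le> ereal c" by simp
  qed
  also have "ereal c < 1" using M by (simp add: c_def)
  finally show ?thesis .
qed

lemma linear_capacity_sum_net_ge_1: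
  assumes "2 \<le> M" "of_nat (M - 1) \<noteq> (0 :: 'f::{field,finite})"
  shows "1 \<le> linear_capacity (sum_net M) TYPE('f)"
  unfolding linear_capacity_def
  using linearly_achievable_sum_net[OF assms] by (intro Sup_upper CollectI exI[of _ 1]) simp

text \<open>The choice \<open>M - 1 = CHAR('k)\<close> makes the upper bound apply over
  \<open>'k\<close>. The two characteristics are distinct primes, so \<open>M - 1\<close> is nonzero
  in \<open>'f\<close> and rate 1 is achieved there.\<close>

lemma linear_capacity_sum_net_CHAR:
  assumes "CHAR('f::{field,finite}) \<noteq> CHAR('k::{field,finite})"
  shows "network (sum_net (Suc CHAR('k))) \<and>
    linear_capacity (sum_net (Suc CHAR('k))) TYPE('k) <
    linear_capacity (sum_net (Suc CHAR('k))) TYPE('f)"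
proof -
  have f: "0 < CHAR('f)" and k: "0 < CHAR('k)" by (rule finite_imp_CHAR_pos, simp)+
  then have "prime CHAR('f)" "prime CHAR('k)" by (simp_all add: prime_CHAR_semidom)
  then have "of_nat CHAR('k) \<noteq> (0 :: 'f)"
    using assms primes_dvd_imp_eq by (auto simp: of_nat_eq_0_iff_char_dvd)
  then have "1 \<le> linear_capacity (sum_net (Suc CHAR('k))) TYPE('f)"
    using k by (intro linear_capacity_sum_net_ge_1) auto
  with linear_capacity_sum_net_less_1[OF refl, where 'f = 'k] show ?thesis
    by (simp add: network_sum_net)
qed

theorem corollary3p2:
  assumes "CHAR('f::{field,finite}) \<noteq> CHAR('k::{field,finite})"
  shows "\<exists>N1 N2. network N1 \<and> network N2 \<and>
    linear_capacity N1 TYPE('f) > linear_capacity N1 TYPE('k) \<and>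
    linear_capacity N2 TYPE('k) > linear_capacity N2 TYPE('f)"
  using linear_capacity_sum_net_CHAR[OF assms] linear_capacity_sum_net_CHAR[OF assms[symmetric]]
  by blast

end
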